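(* Let $1\le m\le n$, let $\Sigma_s\subset\mathbb{R}^m$ be an $m$-dimensional polytope, let $A=[\mathbf{v}_1,\dots,\mathbf{v}_m]$ be an $n\times m$ real matrix with linearly independent columns, let $\mathbf{x}_0\in\mathbb{R}^n$, and let $\Sigma=\{\mathbf{x}_0+A\mathbf{s}:\mathbf{s}\in\Sigma_s\}\subset\mathbb{R}^n$. Let $\sigma_s\subset\partial\Sigma_s$ be any flat face with unit outward normal $\mathbf{n}_s\in\mathbb{R}^m$, and let $\sigma\subset\partial\Sigma$ be its image under $\mathbf{s}\mapsto\mathbf{x}_0+A\mathbf{s}$. Then $$ \frac{|\sigma|^2}{|\sigma_s|^2} = \det(A^\top A) \bigl( (A^\top A)^{-1} \mathbf{n}_s, \mathbf{n}_s \bigr), $$ and equivalently $$ \frac{|\sigma|^2}{|\sigma_s|^2} = \bigl( \operatorname{Cof}(A^\top A)\, \mathbf{n}_s, \mathbf{n}_s \bigr). $$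
   Context: $|\sigma_s|$ and $|\sigma|$ denote $(m-1)$-dimensional measures; $(\cdot,\cdot)$ is the Euclidean inner product on $\mathbb{R}^m$; $\operatorname{Cof}(M)$ is the cofactor matrix of a square matrix $M$, so that $\det(M)M^{-1}=\operatorname{Cof}(M)^\top$ for invertible $M$. A polytope in $\mathbb{R}^m$ is a compact set that is the closure of its nonempty interior and whose boundary consists of finitely many flat $(m-1)$-dimensional faces. *)

theory Defs
  imports "HOL-Analysis.Analysis"
begin

text \<open>
  An orthonormal frame of a \<open>k\<close>-dimensional affine subspace containing \<open>S\<close>: \<open>p\<close> is a base point,
  \<open>e 0, \<dots>, e (k - 1)\<close> are the directions. For \<open>k = 0\<close> the subspace is \<open>{p}\<close>.
\<close>

definition flat_frame :: "nat \<Rightarrow> 'a::euclidean_space set \<Rightarrow> 'a \<Rightarrow> (nat \<Rightarrow> 'a) \<Rightarrow> bool" where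
  "flat_frame k S p e \<longleftrightarrow>
     (\<forall>i<k. \<forall>j<k. e i \<bullet> e j = (if i = j then 1 else 0)) \<and>
     S \<subseteq> range (\<lambda>c. p + (\<Sum>i<k. c i *\<^sub>R e i))"

text \<open>
  The \<open>k\<close>-dimensional measure of a subset of a \<open>k\<close>-dimensional affine subspace of Euclidean space:
  Lebesgue measure on \<open>\<real>\<^sup>k\<close> of its coordinate set in an orthonormal frame. As Lebesgue measure is
  invariant under isometries, the choice of frame is immaterial. For \<open>k = 0\<close> the product measure is
  the unit point mass, so a single point has measure 1.
\<close>

definition flat_measure :: "nat \<Rightarrow> 'a::euclidean_space set \<Rightarrow> real" where
  "flat_measure k S =
     (let (p, e) = (SOME (p, e). flat_frame k S p e)
      in measure (completion (Pi\<^sub>M {..<k} (\<lambda>_. lborel)))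
           {c \<in> {..<k} \<rightarrow>\<^sub>E UNIV. p + (\<Sum>i<k. c i *\<^sub>R e i) \<in> S})"

text \<open>
  Neither a face nor a polytope is required to be convex, unlike \<open>face_of\<close> and \<open>polytope\<close>
  in the library. A flat face of \<open>P\<close> is a compact part of the boundary of \<open>P\<close> that lies in a
  hyperplane and is the closure of its nonempty interior relative to that hyperplane.
\<close>

definition flat_face :: "'a::euclidean_space set \<Rightarrow> 'a set \<Rightarrow> bool" where
  "flat_face P F \<longleftrightarrow>
     F \<subseteq> frontier P \<and> compact F \<and> aff_dim F = int DIM('a) - 1 \<and>
     rel_interior F \<noteq> {} \<and> F = closure (rel_interior F)"

definition flat_polytope :: "'a::euclidean_space set \<Rightarrow> bool" where
  "flat_polytope P \<longleftrightarrow>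
     compact P \<and> interior P \<noteq> {} \<and> P = closure (interior P) \<and>
     (\<exists>\<F>. finite \<F> \<and> (\<forall>F\<in>\<F>. flat_face P F) \<and> frontier P = \<Union>\<F>)"

text \<open>
  The normal has to point out of \<open>P\<close> only at a dense set of points of the face: other
  parts of a non-convex \<open>P\<close> may touch the face from outside, even at relatively interior points.
\<close>

definition outward_unit_normal :: "'a::euclidean_space set \<Rightarrow> 'a set \<Rightarrow> 'a \<Rightarrow> bool" where
  "outward_unit_normal P F \<nu> \<longleftrightarrow>
     norm \<nu> = 1 \<and> (\<forall>x\<in>F. \<forall>y\<in>F. \<nu> \<bullet> (x - y) = 0) \<and>
     F \<subseteq> closure {x \<in> F. \<exists>\<epsilon>>0. \<forall>t. 0 < t \<and> t < \<epsilon> \<longrightarrow> x + t *\<^sub>R \<nu> \<notin> P \<and> x - t *\<^sub>R \<nu> \<in> P}"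

text \<open>
  The index type carries no order, so the signed minor is written as the determinant of the full
  matrix with row \<open>i\<close> and column \<open>j\<close> cleared and a 1 at their crossing; this equals
  \<open>(-1)\<^sup>i\<^sup>+\<^sup>j\<close> times the minor for any enumeration of the indices.
\<close>

definition cofactor_matrix :: "'a::comm_ring_1^'n^'n \<Rightarrow> 'a^'n^'n" where
  "cofactor_matrix M =
     (\<chi> i j. det (\<chi> k l. if k = i \<and> l = j then 1 else if k = i \<or> l = j then 0 else M $ k $ l))"

lemma cofactor_matrix_row:
  fixes M :: "'a::comm_ring_1^'n^'n"
  shows "cofactor_matrix M $ i $ j = det (\<chi> k. if k = i then axis j 1 else M $ k)"
proof -
  have *: "(\<Prod>k\<in>UNIV. if k = i \<and> p k = j then 1 else if k = i \<or> p k = j then 0 else M $ k $ p k)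
      = (\<Prod>k\<in>UNIV. (if k = i then axis j 1 else M $ k) $ p k)" (is "prod ?f _ = prod ?g _")
    if p: "p permutes UNIV" for p :: "'n \<Rightarrow> 'n"
  proof (cases "p i = j")
    case True
    then have "p k \<noteq> j" if "k \<noteq> i" for k
      using permutes_inj[OF p] that by (auto dest: injD)
    then have "?f k = ?g k" for k
      using True by (auto simp: axis_def)
    then show ?thesis by (intro prod.cong refl)
  next
    case False
    then have "?f i = 0" "?g i = 0" by (auto simp: axis_def)
    then have "\<exists>k\<in>UNIV. ?f k = 0" "\<exists>k\<in>UNIV. ?g k = 0" by blast+
    then show ?thesis by (simp only: prod_zero[OF finite])
  qed
  show ?thesis
    unfolding cofactor_matrix_def det_def vec_lambda_beta
    by (rule sum.cong[OF refl]) (simp only: mem_Collect_eq *)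
qed

lemma mult_transpose_cofactor_matrix:
  fixes M :: "real^'n^'n"
  shows "M ** transpose (cofactor_matrix M) = det M *\<^sub>R mat 1"
proof -
  have "(\<Sum>j\<in>UNIV. M $ l $ j * cofactor_matrix M $ i $ j) = (if l = i then det M else 0)" for l i
  proof -
    have "(\<Sum>j\<in>UNIV. M $ l $ j * cofactor_matrix M $ i $ j)
        = (\<Sum>j\<in>UNIV. det (\<chi> k. if k = i then M $ l $ j *s axis j 1 else M $ k))"
      unfolding cofactor_matrix_row by (simp add: det_row_mul)
    also have "\<dots> = det (\<chi> k. if k = i then (\<Sum>j\<in>UNIV. M $ l $ j *s axis j 1) else M $ k)"
      by (rule det_linear_row_sum[symmetric]) simp
    also have "(\<Sum>j\<in>UNIV. M $ l $ j *s axis j 1) = M $ l"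
      by (rule basis_expansion)
    also have "det (\<chi> k. if k = i then M $ l else M $ k) = (if l = i then det M else 0)"
    proof (cases "l = i")
      case True
      then have "(\<chi> k. if k = i then M $ l else M $ k) = M" by (simp add: vec_eq_iff)
      then show ?thesis using True by simp
    next
      case False
      then show ?thesis
        by (auto intro!: det_identical_rows[of l i] simp: row_def)
    qed
    finally show ?thesis .
  qed
  then have "(M ** transpose (cofactor_matrix M)) $ l $ i = (if l = i then det M else 0)" for l i
    by (simp only: matrix_matrix_mult_def transpose_def vec_lambda_beta)
  then show ?thesis
    by (simp add: vec_eq_iff mat_def)
qed

lemma det_matrix_inv_cofactor_matrix:
  fixes M :: "real^'n^'n"
  assumes "invertible M"
  shows "det M *\<^sub>R matrix_inv M = transpose (cofactor_matrix M)"
proof -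
  have "\<exists>N. M ** N = mat 1 \<and> N ** M = mat 1"
    using assms by (simp add: invertible_def)
  from someI_ex[OF this] have inv: "matrix_inv M ** M = mat 1"
    unfolding matrix_inv_def by (rule conjunct2)
  have "transpose (cofactor_matrix M) = (matrix_inv M ** M) ** transpose (cofactor_matrix M)"
    by (simp only: inv matrix_mul_lid)
  also have "\<dots> = matrix_inv M ** (det M *\<^sub>R mat 1)"
    by (simp only: matrix_mul_assoc[symmetric] mult_transpose_cofactor_matrix)
  also have "\<dots> = det M *\<^sub>R matrix_inv M"
    by (simp add: vec_eq_iff matrix_matrix_mult_def mat_def if_distrib cong: if_cong)
  finally show ?thesis by simp
qed

end

theory Submission
  imports Defs
begin

text \<open>
  The idea is to erect a prism over the face and to compute its volume in two ways.
  
  Let \<open>k = m - 1\<close>, let \<open>P = {s + t \<nu> | s \<in> \<sigma>\<^sub>s, 0 \<le> t \<le> 1}\<close>, and identify the range of \<open>A\<close> isometrically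
  with \<open>\<real>\<^sup>m\<close> by means of an orthonormal basis. In these coordinates \<open>A\<close> becomes an \<open>m \<times> m\<close> matrix \<open>V\<close>
  with \<open>V\<^sup>T V = A\<^sup>T A\<close>, so the image of \<open>P\<close> has volume \<open>\<bar>det V\<bar> |P|\<close>, where \<open>(det V)\<^sup>2 = det (A\<^sup>T A)\<close>.
  On the other hand that image is a slanted prism with base \<open>\<sigma>\<close>, up to a translation. If \<open>N = A w\<close> is the
  unit normal of \<open>\<sigma>\<close> inside the range of \<open>A\<close>, its height is \<open>\<mu> = N \<bullet> A \<nu>\<close>, and by Cavalieri's principle
  its volume is \<open>\<mu> |\<sigma>|\<close>. Hence \<open>\<mu>\<^sup>2 |\<sigma>|\<^sup>2 = det (A\<^sup>T A) |P|\<^sup>2\<close>.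
  
  To find \<open>\<mu>\<close>, observe that \<open>N\<close> is orthogonal to \<open>A d\<close> for every \<open>d\<close> orthogonal to \<open>\<nu>\<close>. This says that
  \<open>A\<^sup>T A w\<close> is a multiple of \<open>\<nu>\<close>, and taking the inner product with \<open>\<nu>\<close> shows that it is \<open>\<mu> \<nu>\<close>. So
  \<open>w = \<mu> (A\<^sup>T A)\<^sup>-\<^sup>1 \<nu>\<close>, and \<open>1 = N \<bullet> N = w \<bullet> A\<^sup>T A w = \<mu>\<^sup>2 ((A\<^sup>T A)\<^sup>-\<^sup>1 \<nu>) \<bullet> \<nu>\<close>. Altogether
  \<open>|\<sigma>|\<^sup>2 = det (A\<^sup>T A) ((A\<^sup>T A)\<^sup>-\<^sup>1 \<nu> \<bullet> \<nu>) |P|\<^sup>2\<close> (\<open>flat_measure_matrix_image\<close>). The same formula for the identity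
  matrix reads \<open>|\<sigma>\<^sub>s|\<^sup>2 = |P|\<^sup>2\<close>, and \<open>|P| > 0\<close> because \<open>\<sigma>\<^sub>s\<close> has an interior point relative to its
  hyperplane; dividing gives the first formula. The second one is the adjugate formula for the inverse.
  
  The two volume computations are \<open>emeasure_lborel_linear_image\<close> and \<open>slanted_prism_volume\<close>. They are
  compared in \<open>prism_image_volume\<close>, for an arbitrary orthonormal frame of the hyperplane of \<open>\<sigma>\<close> in the range;
  thus independence of the measure from the frame comes out of the argument instead of entering it.
\<close>

section \<open>Lebesgue measure under linear maps\<close>

lemma nn_integral_lborel_translate_real:
  fixes g :: "real \<Rightarrow> ennreal"
  assumes [measurable]: "g \<in> borel_measurable borel"
  shows "(\<integral>\<^sup>+y. g (y + t) \<partial>lborel) = (\<integral>\<^sup>+y. g y \<partial>lborel)"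
  using nn_integral_real_affine[of g 1 t] assms by (simp add: add.commute)

text \<open>
  By Fubini the coordinate along \<open>b\<close> can be integrated first, and on each line in that direction the shear
  is a translation.
\<close>

lemma nn_integral_lborel_shear:
  fixes g :: "'a::euclidean_space \<Rightarrow> ennreal"
  assumes [measurable]: "g \<in> borel_measurable borel"
    and b: "b \<in> Basis" and b': "b' \<in> Basis" and ne: "b \<noteq> b'"
  shows "(\<integral>\<^sup>+x. g (x + (x \<bullet> b') *\<^sub>R b) \<partial>lborel) = (\<integral>\<^sup>+x. g x \<partial>lborel)"
proof -
  interpret P: product_sigma_finite "\<lambda>_::'a. lborel :: real measure"
    by standard
  let ?B = "Basis - {b}"
  let ?S = "\<lambda>\<omega>. \<Sum>a\<in>?B. \<omega> a *\<^sub>R a"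
  have fubini: "(\<integral>\<^sup>+x. h x \<partial>lborel) = (\<integral>\<^sup>+\<omega>. (\<integral>\<^sup>+y. h (?S \<omega> + y *\<^sub>R b) \<partial>lborel) \<partial>Pi\<^sub>M ?B (\<lambda>_. lborel))"
    if [measurable]: "h \<in> borel_measurable borel" for h :: "'a \<Rightarrow> ennreal"
  proof -
    have ins: "insert b ?B = Basis" using b by auto
    have upd: "(\<Sum>a\<in>insert b ?B. (fun_upd \<omega> b y) a *\<^sub>R a) = ?S \<omega> + y *\<^sub>R b" for \<omega> y
      by (subst sum.insert) (auto simp: add.commute intro!: sum.cong)
    have "(\<integral>\<^sup>+x. h x \<partial>lborel) = (\<integral>\<^sup>+\<omega>. h (\<Sum>a\<in>Basis. \<omega> a *\<^sub>R a) \<partial>Pi\<^sub>M Basis (\<lambda>_. lborel))"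
      by (subst lborel_eq) (simp add: nn_integral_distr)
    also have "\<dots> = (\<integral>\<^sup>+\<omega>. h (\<Sum>a\<in>insert b ?B. \<omega> a *\<^sub>R a) \<partial>Pi\<^sub>M (insert b ?B) (\<lambda>_. lborel))"
      by (simp only: ins)
    also have "\<dots> = (\<integral>\<^sup>+\<omega>. (\<integral>\<^sup>+y. h (\<Sum>a\<in>insert b ?B. (fun_upd \<omega> b y) a *\<^sub>R a) \<partial>lborel) \<partial>Pi\<^sub>M ?B (\<lambda>_. lborel))"
      by (rule P.product_nn_integral_insert) auto
    also have "\<dots> = (\<integral>\<^sup>+\<omega>. (\<integral>\<^sup>+y. h (?S \<omega> + y *\<^sub>R b) \<partial>lborel) \<partial>Pi\<^sub>M ?B (\<lambda>_. lborel))"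
      by (simp only: upd)
    finally show ?thesis .
  qed
  have coord: "(?S \<omega> + y *\<^sub>R b) \<bullet> b' = \<omega> b'" for \<omega> y
    using b b' ne by (simp add: inner_add_left inner_sum_left inner_not_same_Basis
        inner_Basis if_distrib sum.delta cong: if_cong)
  have "(\<integral>\<^sup>+x. g (x + (x \<bullet> b') *\<^sub>R b) \<partial>lborel)
      = (\<integral>\<^sup>+\<omega>. (\<integral>\<^sup>+y. g (?S \<omega> + y *\<^sub>R b + ((?S \<omega> + y *\<^sub>R b) \<bullet> b') *\<^sub>R b) \<partial>lborel) \<partial>Pi\<^sub>M ?B (\<lambda>_. lborel))"
    by (rule fubini) measurable
  also have "\<dots> = (\<integral>\<^sup>+\<omega>. (\<integral>\<^sup>+y. g (?S \<omega> + (y + \<omega> b') *\<^sub>R b) \<partial>lborel) \<partial>Pi\<^sub>M ?B (\<lambda>_. lborel))"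
    by (simp only: coord) (simp add: algebra_simps)
  also have "\<dots> = (\<integral>\<^sup>+\<omega>. (\<integral>\<^sup>+y. g (?S \<omega> + y *\<^sub>R b) \<partial>lborel) \<partial>Pi\<^sub>M ?B (\<lambda>_. lborel))"
    by (intro nn_integral_cong nn_integral_lborel_translate_real) measurable
  also have "\<dots> = (\<integral>\<^sup>+x. g x \<partial>lborel)"
    by (rule fubini[symmetric]) measurable
  finally show ?thesis .
qed

text \<open>
  A permutation of the coordinates maps boxes to boxes with the same side lengths.
\<close>

lemma nn_integral_lborel_permute_coordinates:
  fixes g :: "real^'n \<Rightarrow> ennreal" and \<pi> :: "'n \<Rightarrow> 'n"
  assumes [measurable]: "g \<in> borel_measurable borel" and \<pi>: "bij \<pi>"
  shows "(\<integral>\<^sup>+x. g (\<chi> i. x $ \<pi> i) \<partial>lborel) = (\<integral>\<^sup>+x. g x \<partial>lborel)"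
proof -
  let ?T = "\<lambda>x::real^'n. \<chi> i. x $ \<pi> i"
  have "linear ?T" by (auto intro!: linearI simp: vec_eq_iff)
  then have T [measurable]: "?T \<in> borel_measurable borel"
    by (intro borel_measurable_continuous_onI linear_continuous_on) (simp add: linear_conv_bounded_linear)
  have "lborel = distr lborel borel ?T"
  proof (rule lborel_eqI)
    fix l u :: "real^'n"
    assume le: "\<And>b. b \<in> Basis \<Longrightarrow> l \<bullet> b \<le> u \<bullet> b"
    then have le': "l $ i \<le> u $ i" for i
      using axis_in_Basis_iff[of i "1::real"] by (metis cart_eq_inner_axis insertI1 Basis_real_def)
    have pre: "?T -` box l u = box (\<chi> i. l $ inv \<pi> i) (\<chi> i. u $ inv \<pi> i)"
      using \<pi> by (auto simp: mem_box_cart bij_inv_eq_iff) (metis bij_inv_eq_iff)+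
    have card: "emeasure lborel (box a b) = (\<Prod>i\<in>UNIV. ennreal (b $ i - a $ i))"
      if "\<And>i. a $ i \<le> b $ i" for a b :: "real^'n"
    proof -
      have "emeasure lborel (box a b) = ennreal (\<Prod>c\<in>Basis. (b - a) \<bullet> c)"
        using that by (intro emeasure_lborel_box) (auto simp: Basis_vec_def inner_axis)
      also have "(\<Prod>c\<in>Basis. (b - a) \<bullet> c) = (\<Prod>i\<in>UNIV. (b - a) \<bullet> axis i 1)"
        by (simp add: Basis_vec_def UNION_singleton_eq_range prod.reindex inj_on_def axis_eq_axis)
      finally show ?thesis using that by (simp add: inner_axis prod_ennreal)
    qed
    have "emeasure (distr lborel borel ?T) (box l u) = emeasure lborel (?T -` box l u)"
      by (subst emeasure_distr) auto
    also have "\<dots> = (\<Prod>i\<in>UNIV. ennreal (u $ inv \<pi> i - l $ inv \<pi> i))"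
      unfolding pre using le' by (subst card) auto
    also have "\<dots> = (\<Prod>i\<in>UNIV. ennreal (u $ i - l $ i))"
      by (rule prod.reindex_bij_betw) (use \<pi> bij_imp_bij_inv in auto)
    also have "\<dots> = emeasure lborel (box l u)" by (rule card[symmetric]) (rule le')
    finally show "emeasure (distr lborel borel ?T) (box l u) = (\<Prod>b\<in>Basis. (u - l) \<bullet> b)"
      using le by simp
  qed simp
  then have "(\<integral>\<^sup>+x. g x \<partial>lborel) = (\<integral>\<^sup>+x. g x \<partial>distr lborel borel ?T)" by simp
  also have "\<dots> = (\<integral>\<^sup>+x. g (?T x) \<partial>lborel)"
    by (rule nn_integral_distr) auto
  finally show ?thesis by simp
qed

lemma nn_integral_lborel_stretch:
  fixes g :: "real^'n \<Rightarrow> ennreal"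
  assumes [measurable]: "g \<in> borel_measurable borel" and c: "\<And>i. c i \<noteq> 0"
  shows "(\<integral>\<^sup>+x. g x \<partial>lborel) = ennreal \<bar>prod c UNIV\<bar> * (\<integral>\<^sup>+x. g (\<chi> i. c i * x $ i) \<partial>lborel)"
proof -
  let ?c = "\<lambda>b::real^'n. c (axis_index b)"
  let ?T = "\<lambda>x::real^'n. 0 + (\<Sum>j\<in>Basis. (?c j * (x \<bullet> j)) *\<^sub>R j)"
  have [measurable]: "?T \<in> borel_measurable borel" by measurable
  have ai: "axis_index (axis i 1 :: real^'n) = i" for i
    using axis_index_axis by simp
  have sumB: "(\<Sum>j\<in>Basis. h j) = (\<Sum>i\<in>UNIV. h (axis i 1))" for h :: "real^'n \<Rightarrow> real^'n"
    by (simp add: Basis_vec_def UNION_singleton_eq_range sum.reindex inj_on_def axis_eq_axis)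
  have T: "?T x = (\<chi> i. c i * x $ i)" for x
    unfolding sumB ai inner_axis by (simp add: vec_eq_iff axis_def if_distrib cong: if_cong)
  have P: "(\<Prod>j\<in>Basis. \<bar>?c j\<bar>) = \<bar>prod c UNIV\<bar>"
    by (simp add: Basis_vec_def UNION_singleton_eq_range prod.reindex inj_on_def axis_eq_axis ai abs_prod)
  have "(\<integral>\<^sup>+x. g x \<partial>lborel)
      = (\<integral>\<^sup>+x. g x \<partial>density (distr lborel borel ?T) (\<lambda>_. (\<Prod>j\<in>Basis. \<bar>?c j\<bar>)))"
    by (subst lborel_affine_euclidean[of ?c 0]) (use c in auto)
  also have "\<dots> = (\<integral>\<^sup>+x. ennreal \<bar>prod c UNIV\<bar> * g x \<partial>distr lborel borel ?T)"
    unfolding P by (rule nn_integral_density) auto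
  also have "\<dots> = ennreal \<bar>prod c UNIV\<bar> * (\<integral>\<^sup>+x. g (?T x) \<partial>lborel)"
    by (subst nn_integral_distr) (auto simp: nn_integral_cmult)
  finally show ?thesis unfolding T .
qed

text \<open>
  The change of variables formula for an invertible linear map. Both sides are multiplicative in \<open>f\<close>, so
  it suffices to treat the elementary maps into which \<open>f\<close> decomposes: diagonal maps, transpositions of two
  coordinates, and shears.
\<close>

lemma nn_integral_lborel_linear:
  fixes f :: "real^'n \<Rightarrow> real^'n"
  assumes "linear f" "det (matrix f) \<noteq> 0" "g \<in> borel_measurable borel"
  shows "(\<integral>\<^sup>+x. g x \<partial>lborel) = ennreal \<bar>det (matrix f)\<bar> * (\<integral>\<^sup>+x. g (f x) \<partial>lborel)"
proof -
  let ?P = "\<lambda>f::real^'n \<Rightarrow> real^'n. det (matrix f) \<noteq> 0 \<longrightarrow> (\<forall>g\<in>borel_measurable borel.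
     (\<integral>\<^sup>+x. g x \<partial>lborel) = ennreal \<bar>det (matrix f)\<bar> * (\<integral>\<^sup>+x. g (f x) \<partial>lborel))"
  have "?P f"
  proof (rule induct_linear_elementary[of f ?P])
    show "linear f" by fact
  next
    fix f h :: "real^'n \<Rightarrow> real^'n"
    assume lin: "linear f" "linear h" and P: "?P f" "?P h"
    show "?P (f \<circ> h)"
    proof (intro impI ballI)
      fix g :: "real^'n \<Rightarrow> ennreal"
      assume "det (matrix (f \<circ> h)) \<noteq> 0" and g [measurable]: "g \<in> borel_measurable borel"
      then have d: "det (matrix (f \<circ> h)) = det (matrix f) * det (matrix h)"
        "det (matrix f) \<noteq> 0" "det (matrix h) \<noteq> 0"
        using lin by (auto simp: matrix_compose det_mul)
      have [measurable]: "f \<in> borel_measurable borel"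
        using lin by (intro borel_measurable_continuous_onI linear_continuous_on)
          (simp add: linear_conv_bounded_linear)
      have "(\<integral>\<^sup>+x. g x \<partial>lborel) = ennreal \<bar>det (matrix f)\<bar> * (\<integral>\<^sup>+x. g (f x) \<partial>lborel)"
        using P(1) d g by blast
      also have "(\<integral>\<^sup>+x. g (f x) \<partial>lborel) = ennreal \<bar>det (matrix h)\<bar> * (\<integral>\<^sup>+x. g (f (h x)) \<partial>lborel)"
        using P(2)[rule_format, of "\<lambda>x. g (f x)"] d by simp
      finally show "(\<integral>\<^sup>+x. g x \<partial>lborel)
          = ennreal \<bar>det (matrix (f \<circ> h))\<bar> * (\<integral>\<^sup>+x. g ((f \<circ> h) x) \<partial>lborel)"
        by (simp add: d(1) abs_mult ennreal_mult mult.assoc)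
    qed
  next
    fix f :: "real^'n \<Rightarrow> real^'n" and i
    assume lin: "linear f" and z: "\<And>x. f x $ i = 0"
    have "row i (matrix f) = 0" by (simp add: row_def matrix_def z vec_eq_iff)
    then show "?P f" by (simp add: det_zero_row)
  next
    fix c :: "'n \<Rightarrow> real"
    have "det (matrix (\<lambda>x::real^'n. \<chi> i. c i * x $ i)) = prod c UNIV"
      by (subst det_diagonal) (auto simp: matrix_def axis_def)
    then show "?P (\<lambda>x. \<chi> i. c i * x $ i)"
      using nn_integral_lborel_stretch[where c = c] by (auto simp: prod_zero_iff)
  next
    fix m n :: 'n
    assume "m \<noteq> n"
    let ?\<tau> = "Transposition.transpose m n"
    let ?f = "\<lambda>x::real^'n. \<chi> i. x $ ?\<tau> i"
    have lin: "linear ?f" by (auto intro!: linearI simp: vec_eq_iff)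
    \<comment> \<open>The map is an involution, so its determinant squares to 1.\<close>
    have "?f \<circ> ?f = id" by (simp add: fun_eq_iff vec_eq_iff)
    then have "matrix ?f ** matrix ?f = mat 1"
      by (metis lin matrix_compose matrix_id_mat_1)
    then have "det (matrix ?f) * det (matrix ?f) = 1"
      by (metis det_mul det_I)
    then have "\<bar>det (matrix ?f)\<bar> = 1"
      by (metis abs_mult_self_eq abs_mult abs_one real_sqrt_abs2 real_sqrt_one)
    then show "?P ?f"
      using nn_integral_lborel_permute_coordinates[of _ ?\<tau>] by simp
  next
    fix m n :: 'n
    assume mn: "m \<noteq> n"
    let ?f = "\<lambda>x::real^'n. \<chi> i. if i = m then x $ m + x $ n else x $ i"
    have "matrix ?f = (\<chi> k. if k = m then row m (mat 1) + 1 *s row n (mat 1) else row k (mat 1))"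
      by (auto simp: matrix_def row_def mat_def vec_eq_iff axis_def)
    then have "det (matrix ?f) = 1"
      using det_row_operation[OF mn, where A = "mat 1 :: real^'n^'n" and c = 1] by simp
    moreover have "?f x = x + (x \<bullet> axis n 1) *\<^sub>R axis m 1" for x
      unfolding inner_axis by (auto simp: vec_eq_iff axis_def)
    ultimately show "?P ?f"
      using nn_integral_lborel_shear[of _ "axis m 1" "axis n (1::real)"] mn
      by (simp add: axis_in_Basis_iff axis_eq_axis)
  qed
  with assms show ?thesis by blast
qed

lemma emeasure_lborel_linear_image:
  fixes f :: "real^'n \<Rightarrow> real^'n"
  assumes lin: "linear f" and inj: "inj f" and S: "compact S"
  shows "emeasure lborel (f ` S) = ennreal \<bar>det (matrix f)\<bar> * emeasure lborel S"
proof -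
  have cont: "continuous_on S f" 
    using lin by (intro linear_continuous_on) (simp add: linear_conv_bounded_linear)
  have "compact (f ` S)" using compact_continuous_image[OF cont S] .
  then have b [measurable]: "f ` S \<in> sets borel" "S \<in> sets borel" using S by (auto simp: borel_compact)
  have "invertible (matrix f)"
    using lin inj by (metis invertible_left_inverse matrix_left_invertible_injective matrix_vector_mul)
  then have det: "det (matrix f) \<noteq> 0" by (simp add: invertible_det_nz)
  have "emeasure lborel (f ` S) = (\<integral>\<^sup>+x. indicator (f ` S) x \<partial>lborel)"
    by simp
  also have "\<dots> = ennreal \<bar>det (matrix f)\<bar> * (\<integral>\<^sup>+x. indicator (f ` S) (f x) \<partial>lborel)"
    by (rule nn_integral_lborel_linear[OF lin det]) simp
  also have "(\<lambda>x. indicator (f ` S) (f x) :: ennreal) = indicator S"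
    using inj by (auto simp: indicator_def fun_eq_iff inj_image_mem_iff)
  finally show ?thesis by simp
qed

section \<open>Slanted prisms in a product of lines\<close>

text \<open>
  Lebesgue measure as a product measure whose factors are numbered. This connects \<open>\<real>\<^sup>m\<close>, whose dimension is
  a type, with the products over \<open>{..<k}\<close> in terms of which \<^const>\<open>flat_measure\<close> is defined.
\<close>

lemma lborel_distr_basis_enum:
  fixes \<beta> :: "nat \<Rightarrow> 'a::euclidean_space"
  assumes \<beta>: "bij_betw \<beta> I Basis" and fin: "finite I"
  shows "lborel = distr (Pi\<^sub>M I (\<lambda>_. lborel)) borel (\<lambda>c. \<Sum>i\<in>I. c i *\<^sub>R \<beta> i)"
proof (rule lborel_eqI)
  interpret P: product_sigma_finite "\<lambda>_::nat. lborel :: real measure"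
    by standard
  fix l u :: 'a
  assume le: "\<And>b. b \<in> Basis \<Longrightarrow> l \<bullet> b \<le> u \<bullet> b"
  have \<beta>B: "\<beta> i \<in> Basis" if "i \<in> I" for i
    using \<beta> that by (auto simp: bij_betw_def)
  have coord: "(\<Sum>i\<in>I. c i *\<^sub>R \<beta> i) \<bullet> \<beta> j = c j" if "j \<in> I" for c j
  proof -
    have "\<beta> i \<bullet> \<beta> j = (if i = j then 1 else 0)" if "i \<in> I" for i
      using \<beta> that \<open>j \<in> I\<close> \<beta>B by (auto simp: inner_Basis bij_betw_def inj_on_def)
    then have "(\<Sum>i\<in>I. c i *\<^sub>R \<beta> i) \<bullet> \<beta> j = (\<Sum>i\<in>I. if i = j then c i else 0)"
      by (auto simp: inner_sum_left intro!: sum.cong)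
    then show ?thesis
      using that fin by simp
  qed
  have pre: "(\<lambda>c. \<Sum>i\<in>I. c i *\<^sub>R \<beta> i) -` box l u \<inter> space (Pi\<^sub>M I (\<lambda>_. lborel))
      = (\<Pi>\<^sub>E i\<in>I. {l \<bullet> \<beta> i <..< u \<bullet> \<beta> i})"
  proof -
    have B: "Basis = \<beta> ` I" using \<beta> by (simp add: bij_betw_def)
    have "x \<in> box l u \<longleftrightarrow> (\<forall>i\<in>I. l \<bullet> \<beta> i < x \<bullet> \<beta> i \<and> x \<bullet> \<beta> i < u \<bullet> \<beta> i)" for x
      by (simp add: box_def B)
    then show ?thesis
      by (auto simp: space_PiM PiE_iff coord)
  qed
  have "emeasure (distr (Pi\<^sub>M I (\<lambda>_. lborel)) borel (\<lambda>c. \<Sum>i\<in>I. c i *\<^sub>R \<beta> i)) (box l u)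
      = emeasure (Pi\<^sub>M I (\<lambda>_. lborel)) (\<Pi>\<^sub>E i\<in>I. {l \<bullet> \<beta> i <..< u \<bullet> \<beta> i})"
    by (subst emeasure_distr) (auto simp only: pre[symmetric] simp: , measurable)
  also have "\<dots> = (\<Prod>i\<in>I. ennreal ((u - l) \<bullet> \<beta> i))"
    by (subst P.emeasure_PiM) (use fin le \<beta>B in \<open>auto intro!: prod.cong simp: inner_diff_left\<close>)
  also have "\<dots> = ennreal (\<Prod>i\<in>I. (u - l) \<bullet> \<beta> i)"
    by (rule prod_ennreal) (use le \<beta>B in \<open>simp add: inner_diff_left\<close>)
  also have "(\<Prod>i\<in>I. (u - l) \<bullet> \<beta> i) = (\<Prod>b\<in>Basis. (u - l) \<bullet> b)"
    by (rule prod.reindex_bij_betw[OF \<beta>])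
  finally show "emeasure (distr (Pi\<^sub>M I (\<lambda>_. lborel)) borel (\<lambda>c. \<Sum>i\<in>I. c i *\<^sub>R \<beta> i)) (box l u)
      = (\<Prod>b\<in>Basis. (u - l) \<bullet> b)" .
qed simp

lemma emeasure_PiM_lborel_translate:
  fixes a :: "nat \<Rightarrow> real"
  assumes fin: "finite I" and C: "C \<in> sets (Pi\<^sub>M I (\<lambda>_. lborel))"
  shows "emeasure (Pi\<^sub>M I (\<lambda>_. lborel)) {c \<in> space (Pi\<^sub>M I (\<lambda>_. lborel)). (\<lambda>i\<in>I. c i + a i) \<in> C}
       = emeasure (Pi\<^sub>M I (\<lambda>_. lborel)) C"
proof -
  interpret P: product_sigma_finite "\<lambda>_::nat. lborel :: real measure"
    by standard
  let ?M = "Pi\<^sub>M I (\<lambda>_. lborel :: real measure)"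
  let ?T = "\<lambda>c::nat \<Rightarrow> real. \<lambda>i\<in>I. c i + a i"
  have T [measurable]: "?T \<in> measurable ?M ?M"
    by measurable
  have "distr ?M ?M ?T = ?M"
  proof (rule P.PiM_eqI)
    fix A :: "nat \<Rightarrow> real set"
    assume A: "\<And>i. i \<in> I \<Longrightarrow> A i \<in> sets lborel"
    have "emeasure (distr ?M ?M ?T) (Pi\<^sub>E I A) = emeasure ?M (?T -` Pi\<^sub>E I A \<inter> space ?M)"
      using A fin by (intro emeasure_distr T sets_PiM_I_finite) auto
    also have "?T -` Pi\<^sub>E I A \<inter> space ?M = (\<Pi>\<^sub>E i\<in>I. {x. x + a i \<in> A i})"
      by (auto simp: space_PiM PiE_iff)
    also have "emeasure ?M \<dots> = (\<Prod>i\<in>I. emeasure lborel {x. x + a i \<in> A i})"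
      using A fin by (intro P.emeasure_PiM) auto
    also have "\<dots> = (\<Prod>i\<in>I. emeasure lborel (A i))"
    proof (intro prod.cong refl)
      fix i assume "i \<in> I"
      then have [measurable]: "A i \<in> sets borel" using A by simp
      have "{x. x + a i \<in> A i} \<in> sets lborel" by measurable
      then have "emeasure lborel {x. x + a i \<in> A i}
          = (\<integral>\<^sup>+x. indicator {x. x + a i \<in> A i} x \<partial>lborel)"
        by (rule nn_integral_indicator[symmetric])
      also have "\<dots> = (\<integral>\<^sup>+x. indicator (A i) (x + a i) \<partial>lborel)"
        by (intro nn_integral_cong) (simp add: indicator_def)
      also have "\<dots> = emeasure lborel (A i)"
        by (subst nn_integral_lborel_translate_real) auto
      finally show "emeasure lborel {x. x + a i \<in> A i} = emeasure lborel (A i)" .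
    qed
    finally show "emeasure (distr ?M ?M ?T) (Pi\<^sub>E I A) = (\<Prod>i\<in>I. emeasure lborel (A i))" .
  qed (use fin in auto)
  then have "emeasure ?M C = emeasure (distr ?M ?M ?T) C" by simp
  also have "\<dots> = emeasure ?M (?T -` C \<inter> space ?M)"
    using C by (intro emeasure_distr T)
  also have "?T -` C \<inter> space ?M = {c \<in> space ?M. ?T c \<in> C}" by auto
  finally show ?thesis by simp
qed

text \<open>
  Cavalieri's principle for a prism \<open>X\<close> with base \<open>C\<close> and height \<open>\<eta>\<close>, which starts at level \<open>h\<close>: the
  slice at the relative height \<open>t\<close> is \<open>C\<close> translated by \<open>\<delta> + t \<alpha>\<close>, so all slices have the measure of \<open>C\<close>.
  For \<open>k = 0\<close> a nonempty base is a point of measure 1 and the prism is a segment.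
\<close>

lemma slanted_prism_volume:
  fixes \<eta> h :: real and \<alpha> \<delta> :: "nat \<Rightarrow> real"
  assumes C: "C \<in> sets (Pi\<^sub>M {..<k} (\<lambda>_. lborel))" and \<eta>: "\<eta> > 0"
    and X: "X \<in> sets (Pi\<^sub>M {..<Suc k} (\<lambda>_. lborel))"
    and X_iff: "\<And>c t. c \<in> extensional {..<Suc k} \<Longrightarrow> c k = h + t * \<eta> \<Longrightarrow>
      c \<in> X \<longleftrightarrow> t \<in> {0..1} \<and> (\<lambda>i\<in>{..<k}. c i - (\<delta> i + t * \<alpha> i)) \<in> C"
  shows "emeasure (Pi\<^sub>M {..<Suc k} (\<lambda>_. lborel)) X = ennreal \<eta> * emeasure (Pi\<^sub>M {..<k} (\<lambda>_. lborel)) C"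
proof -
  interpret P: product_sigma_finite "\<lambda>_::nat. lborel :: real measure"
    by standard
  let ?M = "Pi\<^sub>M {..<k} (\<lambda>_. lborel :: real measure)"
  have ins: "{..<Suc k} = insert k {..<k}" by auto
  note [measurable] = X[unfolded ins]
  have slice: "(\<integral>\<^sup>+c. indicator X (c(k := y)) \<partial>?M) = indicator {h..h+\<eta>} y * emeasure ?M C" for y
  proof -
    \<comment> \<open>The relative height of the level \<open>y\<close>; the prism occupies the relative heights in \<open>{0..1}\<close>.\<close>
    define t where "t = (y - h) / \<eta>"
    have y: "y = h + t * \<eta>" using \<eta> by (simp add: t_def)
    have t01: "t \<in> {0..1} \<longleftrightarrow> y \<in> {h..h+\<eta>}"
      using \<eta> by (simp add: t_def field_simps)
    have iff: "c(k := y) \<in> X \<longleftrightarrow> t \<in> {0..1} \<and> (\<lambda>i\<in>{..<k}. c i + - (\<delta> i + t * \<alpha> i)) \<in> C"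
      if "c \<in> space ?M" for c
    proof -
      have ext: "c(k := y) \<in> extensional {..<Suc k}"
        using that by (auto simp: space_PiM PiE_def extensional_def)
      have "(\<lambda>i\<in>{..<k}. (c(k := y)) i - (\<delta> i + t * \<alpha> i)) = (\<lambda>i\<in>{..<k}. c i + - (\<delta> i + t * \<alpha> i))"
        by (auto simp: restrict_def)
      then show ?thesis using X_iff[OF ext, of t] y by simp
    qed
    define C' where "C' = {c \<in> space ?M. (\<lambda>i\<in>{..<k}. c i + - (\<delta> i + t * \<alpha> i)) \<in> C}"
    have [measurable]: "C' \<in> sets ?M" unfolding C'_def using C by measurable
    have "(\<integral>\<^sup>+c. indicator X (c(k := y)) \<partial>?M) = (\<integral>\<^sup>+c. indicator {h..h+\<eta>} y * indicator C' c \<partial>?M)"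
      by (intro nn_integral_cong) (auto simp: iff t01 C'_def indicator_def simp del: atLeastAtMost_iff)
    also have "\<dots> = indicator {h..h+\<eta>} y * emeasure ?M C'"
      by (subst nn_integral_cmult) auto
    also have "emeasure ?M C' = emeasure ?M C"
      unfolding C'_def by (rule emeasure_PiM_lborel_translate) (use C in auto)
    finally show ?thesis .
  qed
  have "emeasure (Pi\<^sub>M {..<Suc k} (\<lambda>_. lborel)) X = (\<integral>\<^sup>+c. indicator X c \<partial>Pi\<^sub>M (insert k {..<k}) (\<lambda>_. lborel))"
    using X by (simp add: ins)
  also have "\<dots> = (\<integral>\<^sup>+y. \<integral>\<^sup>+c. indicator X (c(k := y)) \<partial>?M \<partial>lborel)"
    by (rule P.product_nn_integral_insert_rev) auto
  also have "\<dots> = (\<integral>\<^sup>+y. indicator {h..h+\<eta>} y * emeasure ?M C \<partial>lborel)"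
    by (simp only: slice)
  also have "\<dots> = ennreal \<eta> * emeasure ?M C"
    using \<eta> by (subst nn_integral_multc) auto
  finally show ?thesis .
qed

section \<open>Orthonormal frames of flat sets\<close>

lemma inner_orthonormal_sum:
  fixes e :: "nat \<Rightarrow> 'a::real_inner"
  assumes "\<And>i j. i < k \<Longrightarrow> j < k \<Longrightarrow> e i \<bullet> e j = (if i = j then 1 else 0)" "j < k"
  shows "(\<Sum>i<k. c i *\<^sub>R e i) \<bullet> e j = c j"
proof -
  have "(\<Sum>i<k. c i *\<^sub>R e i) \<bullet> e j = (\<Sum>i<k. if i = j then c i else 0)"
    unfolding inner_sum_left by (intro sum.cong) (auto simp: assms)
  then show ?thesis using assms(2) by simp
qed

text \<open>
  An orthonormal basis of the space of directions of the affine hull, based at a point of \<open>S\<close>.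
\<close>

lemma flat_frame_exists:
  fixes S :: "'a::euclidean_space set"
  assumes "aff_dim S = int k"
  shows "\<exists>p e. flat_frame k S p e"
proof -
  have "S \<noteq> {}" using assms by auto
  then obtain a where a: "a \<in> S" by blast
  let ?W = "span ((\<lambda>x. x - a) ` S)"
  obtain B where B: "B \<subseteq> ?W" "pairwise orthogonal B" "\<And>x. x \<in> B \<Longrightarrow> norm x = 1"
    "independent B" "card B = dim ?W" "span B = ?W"
    using orthonormal_basis_subspace[OF subspace_span] by metis
  have "dim ?W = k"
    using aff_dim_eq_dim_subtract[of a S] hull_inc[OF a] assms by simp
  moreover have "finite B" using B(4) independent_imp_finite by blast
  ultimately obtain e where e: "bij_betw e {..<k} B"
    using ex_bij_betw_nat_finite[of B] B(5) by (auto simp: atLeast0LessThan)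
  have "e i \<bullet> e j = (if i = j then 1 else 0)" if "i < k" "j < k" for i j
  proof -
    have "e i \<in> B" "e j \<in> B" "e i = e j \<longleftrightarrow> i = j"
      using e that by (auto simp: bij_betw_def inj_on_def)
    then show ?thesis
      using B(2,3) by (auto simp: pairwise_def orthogonal_def norm_eq_1)
  qed
  moreover have "x \<in> range (\<lambda>c. a + (\<Sum>i<k. c i *\<^sub>R e i))" if "x \<in> S" for x
  proof -
    have "x - a \<in> span B" using that B(6) by (auto intro: span_base)
    then obtain u where "x - a = (\<Sum>v\<in>B. u v *\<^sub>R v)"
      using span_finite[OF \<open>finite B\<close>] by auto
    also have "\<dots> = (\<Sum>i<k. u (e i) *\<^sub>R e i)"
      by (rule sum.reindex_bij_betw[OF e, symmetric])
    finally have "x = a + (\<Sum>i<k. u (e i) *\<^sub>R e i)" by (simp add: algebra_simps)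
    then show ?thesis by (intro range_eqI[where x = "\<lambda>i. u (e i)"])
  qed
  ultimately show ?thesis unfolding flat_frame_def by blast
qed

text \<open>
  The coordinate set that occurs in the definition of \<^const>\<open>flat_measure\<close>.
\<close>

definition frame_coords :: "nat \<Rightarrow> 'a::euclidean_space \<Rightarrow> (nat \<Rightarrow> 'a) \<Rightarrow> 'a set \<Rightarrow> (nat \<Rightarrow> real) set" where
  "frame_coords k p e S = {c \<in> {..<k} \<rightarrow>\<^sub>E UNIV. p + (\<Sum>i<k. c i *\<^sub>R e i) \<in> S}"

lemma sets_frame_coords:
  assumes "closed S"
  shows "frame_coords k p e S \<in> sets (Pi\<^sub>M {..<k} (\<lambda>_. lborel))"
proof -
  have [measurable]: "S \<in> sets borel" using assms by simp
  have "{c \<in> space (Pi\<^sub>M {..<k} (\<lambda>_. lborel)). p + (\<Sum>i<k. c i *\<^sub>R e i) \<in> S}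
      \<in> sets (Pi\<^sub>M {..<k} (\<lambda>_. lborel))"
    by measurable
  then show ?thesis by (simp add: frame_coords_def space_PiM)
qed

text \<open>
  For a closed set of affine dimension \<open>k\<close> the choice in the definition of \<^const>\<open>flat_measure\<close> does yield a
  frame, and the coordinate set is measurable before completion.
\<close>

lemma flat_measure_frame:
  fixes S :: "'a::euclidean_space set"
  assumes "aff_dim S = int k" "closed S"
  obtains p e where "flat_frame k S p e"
    "flat_measure k S = measure (Pi\<^sub>M {..<k} (\<lambda>_. lborel)) (frame_coords k p e S)"
proof -
  obtain p e where pe: "(SOME (p, e). flat_frame k S p e) = (p, e)" by force
  have "flat_frame k S p e"
    using someI_ex[of "\<lambda>(p, e). flat_frame k S p e"] flat_frame_exists[OF assms(1)] pe by auto
  moreover have "flat_measure k S = measure (Pi\<^sub>M {..<k} (\<lambda>_. lborel)) (frame_coords k p e S)"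
    unfolding flat_measure_def pe using sets_frame_coords[OF assms(2), of k p e]
    by (simp add: frame_coords_def)
  ultimately show ?thesis by (rule that)
qed

text \<open>
  The inclusion in the hyperplane is an equality because the dimensions agree.
\<close>

lemma span_differences_hyperplane:
  fixes F :: "'a::euclidean_space set"
  assumes a: "a \<in> F" and dim: "aff_dim F = int DIM('a) - 1" and \<nu>: "\<nu> \<noteq> 0"
    and orth: "\<And>x. x \<in> F \<Longrightarrow> \<nu> \<bullet> (x - a) = 0"
  shows "span ((\<lambda>x. x - a) ` F) = {d. \<nu> \<bullet> d = 0}"
proof (rule subspace_dim_equal)
  show "span ((\<lambda>x. x - a) ` F) \<subseteq> {d. \<nu> \<bullet> d = 0}"
    by (intro span_minimal subspace_hyperplane) (use orth in auto)
  show "dim {d. \<nu> \<bullet> d = 0} \<le> dim (span ((\<lambda>x. x - a) ` F))"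
    using aff_dim_eq_dim_subtract[of a F] hull_inc[OF a] dim dim_hyperplane[OF \<nu>] by simp
qed (auto simp: subspace_hyperplane)

text \<open>
  The differences of points of \<open>f ` F\<close> span a hyperplane of the range of \<open>f\<close>. The unit normal \<open>f w\<close> of this
  hyperplane inside the range arises from \<open>f \<nu>\<close> by the Gram-Schmidt step: subtract the projection to the
  span of the frame and normalise. It completes the frame to an orthonormal basis of the range.
\<close>

lemma unit_normal_in_range:
  fixes f :: "'a::euclidean_space \<Rightarrow> 'b::euclidean_space"
  assumes lin: "linear f" and inj: "inj f" and a: "a \<in> F"
    and dim: "aff_dim F = int k" and DIM: "DIM('a) = Suc k"
    and \<nu>: "\<nu> \<noteq> 0" and orth: "\<forall>x\<in>F. \<forall>y\<in>F. \<nu> \<bullet> (x - y) = 0"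
    and frame: "flat_frame k ((\<lambda>s. x0 + f s) ` F) q e"
  obtains w where "norm (f w) = 1" "\<forall>i<k. f w \<bullet> e i = 0"
    "\<forall>d. \<nu> \<bullet> d = 0 \<longrightarrow> f w \<bullet> f d = 0" "f w \<bullet> f \<nu> > 0"
    "\<forall>s. f s = (\<Sum>i<k. (f s \<bullet> e i) *\<^sub>R e i) + (f s \<bullet> f w) *\<^sub>R f w"
proof -
  interpret linear f by fact
  let ?D = "{d. \<nu> \<bullet> d = 0}"
  let ?E = "span (e ` {..<k})"
  have on: "e i \<bullet> e j = (if i = j then 1 else 0)" if "i < k" "j < k" for i j
    using frame that by (auto simp: flat_frame_def)
  have D: "span ((\<lambda>x. x - a) ` F) = ?D"
    by (rule span_differences_hyperplane) (use a dim DIM \<nu> orth in auto)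
  have inE: "q + x \<in> range (\<lambda>c. q + (\<Sum>i<k. c i *\<^sub>R e i)) \<Longrightarrow> x \<in> ?E" for x
    by (elim rangeE) (simp, intro span_sum span_scale span_base, simp)
  have diff_mem: "f (x - a) \<in> ?E" if "x \<in> F" for x
  proof -
    have "q + (x0 + f y - q) \<in> range (\<lambda>c. q + (\<Sum>i<k. c i *\<^sub>R e i))" if "y \<in> F" for y
      using frame that by (auto simp: flat_frame_def)
    then have "x0 + f x - q \<in> ?E" "x0 + f a - q \<in> ?E"
      using that a inE by blast+
    from span_diff[OF this] show ?thesis by (simp add: diff)
  qed
  have "f ` ?D = span (f ` (\<lambda>x. x - a) ` F)"
    unfolding D[symmetric] by (rule linear_span_image[OF lin, symmetric])
  also have "\<dots> \<subseteq> ?E"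
    by (intro span_minimal subspace_span) (use diff_mem in auto)
  finally have sub: "f ` ?D \<subseteq> ?E" .
  have "dim ?E \<le> k"
    using dim_le_card[of "e ` {..<k}" "e ` {..<k}"] card_image_le[of "{..<k}" e] by (simp add: span_superset)
  also have "k = dim (f ` ?D)"
    using dim_image_eq[OF lin, of ?D] inj dim_hyperplane[OF \<nu>] DIM by (simp add: inj_on_subset)
  finally have E: "f ` ?D = ?E"
    by (intro subspace_dim_equal sub subspace_span linear_subspace_image lin subspace_hyperplane) auto
  have rep: "x = (\<Sum>i<k. (x \<bullet> e i) *\<^sub>R e i)" if "x \<in> ?E" for x
  proof -
    have "orthogonal (x - (\<Sum>i<k. (x \<bullet> e i) *\<^sub>R e i)) y" if "y \<in> e ` {..<k}" for y
      using that inner_orthonormal_sum[OF on] by (auto simp: orthogonal_def inner_diff_left)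
    moreover have "x - (\<Sum>i<k. (x \<bullet> e i) *\<^sub>R e i) \<in> ?E"
      by (intro span_diff that span_sum span_scale span_base) auto
    ultimately have "orthogonal (x - (\<Sum>i<k. (x \<bullet> e i) *\<^sub>R e i)) (x - (\<Sum>i<k. (x \<bullet> e i) *\<^sub>R e i))"
      using orthogonal_to_span by blast
    then show ?thesis by (simp add: orthogonal_def)
  qed
  define P where "P = (\<Sum>i<k. (f \<nu> \<bullet> e i) *\<^sub>R e i)"
  have "P \<in> f ` ?D" unfolding E P_def by (intro span_sum span_scale span_base) auto
  then obtain d0 where d0: "\<nu> \<bullet> d0 = 0" "P = f d0" by auto
  \<comment> \<open>The projection \<open>P\<close> is the image of a vector \<open>d0\<close> of the hyperplane, so the vector \<open>f \<nu> - P\<close>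
    is again in the range of \<open>f\<close>, and injectivity keeps it from being 0.\<close>
  define u where "u = \<nu> - d0"
  have fu: "f u = f \<nu> - P" by (simp add: u_def d0 diff)
  have "u \<noteq> 0" using d0 \<nu> by (auto simp: u_def)
  then have fu0: "norm (f u) > 0" using inj by (metis inj_eq zero zero_less_norm_iff)
  have fue: "f u \<bullet> e i = 0" if "i < k" for i
    using inner_orthonormal_sum[OF on that] by (simp add: fu P_def inner_diff_left)
  have fuE: "f u \<bullet> y = 0" if "y \<in> ?E" for y
    using orthogonal_to_span[of y "e ` {..<k}" "f u"] that fue by (auto simp: orthogonal_def)
  have fu\<nu>: "f u \<bullet> f \<nu> = (norm (f u))\<^sup>2"
  proof -
    have "f u \<bullet> P = 0" using fuE E \<open>P \<in> f ` ?D\<close> by auto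
    then show ?thesis by (simp add: fu power2_norm_eq_inner inner_diff_right)
  qed
  let ?w = "(1 / norm (f u)) *\<^sub>R u"
  have fw: "f ?w = (1 / norm (f u)) *\<^sub>R f u" by (rule scale)
  show thesis
  proof (rule that[of ?w])
    show "norm (f ?w) = 1" using fu0 by (simp add: fw)
    show "\<forall>i<k. f ?w \<bullet> e i = 0" using fue by (simp add: fw)
    show "\<forall>d. \<nu> \<bullet> d = 0 \<longrightarrow> f ?w \<bullet> f d = 0"
    proof (intro allI impI)
      fix d assume "\<nu> \<bullet> d = 0"
      then have "f d \<in> ?E" using E by auto
      from fuE[OF this] show "f ?w \<bullet> f d = 0" by (simp add: fw)
    qed
    show "f ?w \<bullet> f \<nu> > 0" using fu0 by (simp add: fw fu\<nu>)
    show "\<forall>s. f s = (\<Sum>i<k. (f s \<bullet> e i) *\<^sub>R e i) + (f s \<bullet> f ?w) *\<^sub>R f ?w"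
    proof
      fix s
      \<comment> \<open>Choose \<open>r\<close> such that \<open>s - r u\<close> lies in the hyperplane orthogonal to \<open>\<nu>\<close>.\<close>
      define r where "r = (\<nu> \<bullet> s) / (\<nu> \<bullet> \<nu>)"
      have "\<nu> \<bullet> u = \<nu> \<bullet> \<nu>" using d0 by (simp add: u_def inner_diff_right)
      then have "\<nu> \<bullet> (s - r *\<^sub>R u) = 0"
        using \<nu> by (simp add: r_def inner_diff_right)
      then have mem: "f s - r *\<^sub>R f u \<in> ?E"
        using E by (force simp: diff scale)
      have fs: "f s \<bullet> f u = r * (norm (f u))\<^sup>2"
        using fuE[OF mem] by (simp add: inner_diff_right power2_norm_eq_inner inner_commute)
      have "f s - r *\<^sub>R f u = (\<Sum>i<k. ((f s - r *\<^sub>R f u) \<bullet> e i) *\<^sub>R e i)"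
        by (rule rep[OF mem])
      also have "\<dots> = (\<Sum>i<k. (f s \<bullet> e i) *\<^sub>R e i)"
        by (intro sum.cong refl) (simp add: inner_diff_left fue)
      finally have "f s = (\<Sum>i<k. (f s \<bullet> e i) *\<^sub>R e i) + r *\<^sub>R f u" by (simp add: algebra_simps)
      moreover have "(f s \<bullet> f ?w) *\<^sub>R f ?w = r *\<^sub>R f u"
        using fu0 by (simp add: fw fs power2_eq_square)
      ultimately show "f s = (\<Sum>i<k. (f s \<bullet> e i) *\<^sub>R e i) + (f s \<bullet> f ?w) *\<^sub>R f ?w"
        by simp
    qed
  qed
qed

section \<open>The prism over a face and its image\<close>

definition prism :: "'a::real_vector set \<Rightarrow> 'a \<Rightarrow> 'a set" where
  "prism F v = (\<lambda>(s, t). s + t *\<^sub>R v) ` (F \<times> {0..1})"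

lemma compact_prism:
  fixes F :: "'a::euclidean_space set"
  assumes "compact F" shows "compact (prism F v)"
  unfolding prism_def case_prod_unfold
  by (intro compact_continuous_image compact_Times assms continuous_intros compact_Icc)

text \<open>
  The prism contains a ball around the point half way up over a relative interior point of \<open>F\<close>.
\<close>

lemma measure_prism_pos:
  fixes F :: "'a::euclidean_space set"
  assumes F: "compact F" "rel_interior F \<noteq> {}" and dim: "aff_dim F = int DIM('a) - 1"
    and \<nu>: "norm \<nu> = 1" and orth: "\<forall>x\<in>F. \<forall>y\<in>F. \<nu> \<bullet> (x - y) = 0"
  shows "measure lborel (prism F \<nu>) > 0"
proof -
  obtain x r where x: "x \<in> F" "r > 0" and r: "ball x r \<inter> affine hull F \<subseteq> F"
    using F(2) by (auto simp: rel_interior_ball)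
  have "\<nu> \<noteq> 0" using \<nu> by auto
  have D: "span ((\<lambda>y. y - x) ` F) = {d. \<nu> \<bullet> d = 0}"
    by (rule span_differences_hyperplane) (use x dim \<open>\<nu> \<noteq> 0\<close> orth in auto)
  have hull: "x + d \<in> affine hull F" if "\<nu> \<bullet> d = 0" for d
    using affine_hull_span_gen[OF hull_inc[OF x(1)]] that D by (auto simp: image_def)
  have \<nu>\<nu>: "\<nu> \<bullet> \<nu> = 1" using \<nu> by (simp add: norm_eq_1)
  let ?\<rho> = "min (1/2) (r/2)"
  have "ball (x + (1/2) *\<^sub>R \<nu>) ?\<rho> \<subseteq> prism F \<nu>"
  proof
    fix z assume "z \<in> ball (x + (1/2) *\<^sub>R \<nu>) ?\<rho>"
    define u where "u = z - (x + (1/2) *\<^sub>R \<nu>)"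
    have u: "norm u < ?\<rho>"
      using \<open>z \<in> _\<close> by (simp add: u_def dist_norm norm_minus_commute)
    \<comment> \<open>Decompose the displacement from the centre of the ball into its component along \<open>\<nu>\<close> and a
      component \<open>d\<close> in the hyperplane. The radius keeps the former below \<open>1/2\<close> and the latter
      shorter than \<open>r\<close>.\<close>
    define d where "d = u - (\<nu> \<bullet> u) *\<^sub>R \<nu>"
    have nu: "\<bar>\<nu> \<bullet> u\<bar> \<le> norm u" using Cauchy_Schwarz_ineq2[of \<nu> u] \<nu> by simp
    have "norm d \<le> norm u + norm ((\<nu> \<bullet> u) *\<^sub>R \<nu>)" unfolding d_def by (rule norm_triangle_ineq4)
    also have "\<dots> < r" using nu u \<nu> by simp
    finally have "norm d < r" .
    moreover have "\<nu> \<bullet> d = 0" by (simp add: d_def inner_diff_right \<nu>\<nu>)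
    ultimately have "x + d \<in> F" using r hull by (auto simp: dist_norm)
    moreover have "1/2 + \<nu> \<bullet> u \<in> {0..1}" using nu u by (auto simp: abs_le_iff)
    moreover have "z = (x + d) + (1/2 + \<nu> \<bullet> u) *\<^sub>R \<nu>"
      by (simp add: d_def u_def algebra_simps)
    ultimately show "z \<in> prism F \<nu>" unfolding prism_def by force
  qed
  then have "measure lborel (ball (x + (1/2) *\<^sub>R \<nu>) ?\<rho>) \<le> measure lborel (prism F \<nu>)"
    by (intro measure_mono_fmeasurable fmeasurable_compact compact_prism F(1)) auto
  moreover have "measure lborel (ball (x + (1/2) *\<^sub>R \<nu>) ?\<rho>) > 0"
    using x(2) by (intro content_ball_pos) auto
  ultimately show ?thesis by linarith
qed

text \<open>
  The volume of the image of the prism over \<open>F\<close>, computed twice. The map \<open>V\<close> is \<open>f\<close> followed by the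
  isometry from the range of \<open>f\<close> to \<open>\<real>\<^sup>m\<close> which sends the frame and the normal \<open>f w\<close> to the standard basis.
  On the left the image is seen as a slanted prism of height \<open>f w \<bullet> f \<nu>\<close>, on the right as a linear image.
\<close>

lemma prism_image_volume:
  fixes f :: "real^'m \<Rightarrow> 'b::euclidean_space"
  assumes lin: "linear f" and inj: "inj f" and F: "compact F" "F \<noteq> {}"
    and dim: "aff_dim F = int k" and card: "CARD('m) = Suc k"
    and \<nu>: "\<nu> \<noteq> 0" and orth: "\<forall>x\<in>F. \<forall>y\<in>F. \<nu> \<bullet> (x - y) = 0"
    and frame: "flat_frame k ((\<lambda>s. x0 + f s) ` F) q e"
  obtains w V where "norm (f w) = 1"
    "\<forall>d. \<nu> \<bullet> d = 0 \<longrightarrow> f w \<bullet> f d = 0" "f w \<bullet> f \<nu> > 0"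
    "linear V" "\<forall>s t. V s \<bullet> V t = f s \<bullet> f t"
    "measure (Pi\<^sub>M {..<k} (\<lambda>_. lborel)) (frame_coords k q e ((\<lambda>s. x0 + f s) ` F)) * (f w \<bullet> f \<nu>)
       = \<bar>det (matrix V)\<bar> * measure lborel (prism F \<nu>)"
proof -
  interpret linear f by fact
  obtain a where a: "a \<in> F" using F(2) by blast
  have DIM: "DIM(real^'m) = Suc k" using card by simp
  obtain w where w: "norm (f w) = 1" "\<forall>i<k. f w \<bullet> e i = 0"
    "\<forall>d. \<nu> \<bullet> d = 0 \<longrightarrow> f w \<bullet> f d = 0" "f w \<bullet> f \<nu> > 0"
    "\<forall>s. f s = (\<Sum>i<k. (f s \<bullet> e i) *\<^sub>R e i) + (f s \<bullet> f w) *\<^sub>R f w"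
    by (rule unit_normal_in_range[OF lin inj a dim DIM \<nu> orth frame])
  have on: "e i \<bullet> e j = (if i = j then 1 else 0)" if "i < k" "j < k" for i j
    using frame that by (auto simp: flat_frame_def)
  let ?M = "Pi\<^sub>M {..<k} (\<lambda>_. lborel :: real measure)"
  let ?C = "frame_coords k q e ((\<lambda>s. x0 + f s) ` F)"
  let ?I = "{..<Suc k}"
  have "card (Basis :: (real^'m) set) = Suc k" using card by simp
  then obtain \<beta> :: "nat \<Rightarrow> real^'m" where \<beta>: "bij_betw \<beta> ?I Basis"
    using ex_bij_betw_nat_finite[of "Basis :: (real^'m) set"] by (auto simp: atLeast0LessThan)
  have \<beta>on: "\<beta> i \<bullet> \<beta> j = (if i = j then 1 else 0)" if "i < Suc k" "j < Suc k" for i j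
  proof -
    have "\<beta> i \<in> Basis" "\<beta> j \<in> Basis" "\<beta> i = \<beta> j \<longleftrightarrow> i = j"
      using \<beta> that by (auto simp: bij_betw_def inj_on_def)
    then show ?thesis by (simp add: inner_Basis)
  qed
  \<comment> \<open>The frame continued by the unit normal, which takes the last place \<open>k\<close>.\<close>
  define e' where "e' i = (if i < k then e i else f w)" for i
  have e'_less: "e' i = e i" if "i < k" for i using that by (simp add: e'_def)
  have e'k: "e' k = f w" by (simp add: e'_def)
  define V where "V s = (\<Sum>i<Suc k. (f s \<bullet> e' i) *\<^sub>R \<beta> i)" for s
  have Vlin: "linear V"
    unfolding V_def by (intro linearI) (simp_all add: add scale inner_add_left scaleR_add_left scaleR_add_right sum.distrib scaleR_sum_right)
  have V\<beta>: "V s \<bullet> \<beta> i = f s \<bullet> e' i" if "i < Suc k" for s i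
    unfolding V_def by (rule inner_orthonormal_sum[OF \<beta>on that])
  have Vinner: "V s \<bullet> V t = f s \<bullet> f t" for s t
  proof -
    have "V s \<bullet> V t = (\<Sum>i<Suc k. (f t \<bullet> e' i) * (f s \<bullet> e' i))"
      by (subst (2) V_def) (simp only: inner_sum_right inner_scaleR_right, intro sum.cong, auto simp: V\<beta>)
    also have "\<dots> = f s \<bullet> ((\<Sum>i<k. (f t \<bullet> e i) *\<^sub>R e i) + (f t \<bullet> f w) *\<^sub>R f w)"
      by (simp add: inner_add_right inner_sum_right e'_less e'k)
    also have "\<dots> = f s \<bullet> f t" by (simp only: w(5)[rule_format, symmetric])
    finally show ?thesis .
  qed
  have Vinj: "inj V"
  proof (rule injI)
    fix s t assume "V s = V t"
    then have "V (s - t) = 0" using linear_diff[OF Vlin] by simp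
    then have "f (s - t) \<bullet> f (s - t) = 0" using Vinner[of "s - t" "s - t"] by simp
    then have "f s = f t" by (simp add: diff)
    then show "s = t" using inj by (simp add: inj_eq)
  qed
  define Y where "Y = V ` prism F \<nu>"
  have cY: "compact Y"
    unfolding Y_def using Vlin
    by (intro compact_continuous_image linear_continuous_on compact_prism F) (simp add: linear_conv_bounded_linear)
  define X where "X = frame_coords (Suc k) 0 \<beta> Y"
  have Xsets: "X \<in> sets (Pi\<^sub>M ?I (\<lambda>_. lborel))"
    unfolding X_def by (intro sets_frame_coords compact_imp_closed cY)
  have volY: "emeasure lborel Y = emeasure (Pi\<^sub>M ?I (\<lambda>_. lborel)) X"
    using cY by (subst lborel_distr_basis_enum[OF \<beta>])
      (auto simp: emeasure_distr borel_compact X_def frame_coords_def space_PiM intro!: arg_cong2[where f = emeasure])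
  \<comment> \<open>The frame is based at an arbitrary point \<open>q\<close> of the hyperplane. The offset \<open>q - x0\<close> has the
    same component along \<open>f w\<close> as every \<open>f s\<close> with \<open>s \<in> F\<close>; it is the level where the prism starts.\<close>
  have q0: "(x0 + f s - q) = (\<Sum>i<k. ((x0 + f s - q) \<bullet> e i) *\<^sub>R e i)" if "s \<in> F" for s
  proof -
    have "x0 + f s \<in> range (\<lambda>c. q + (\<Sum>i<k. c i *\<^sub>R e i))"
      using frame that by (auto simp: flat_frame_def)
    then obtain c where c: "x0 + f s = q + (\<Sum>i<k. c i *\<^sub>R e i)"
      by (elim rangeE)
    have "(x0 + f s - q) \<bullet> e i = c i" if "i < k" for i
      using inner_orthonormal_sum[OF on that] by (simp add: c)
    then show ?thesis by (simp add: c)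
  qed
  have qN: "f s \<bullet> f w = (q - x0) \<bullet> f w" if "s \<in> F" for s
  proof -
    have "(x0 + f s - q) \<bullet> f w = (\<Sum>i<k. ((x0 + f s - q) \<bullet> e i) *\<^sub>R e i) \<bullet> f w"
      using q0[OF that] by simp
    also have "\<dots> = 0"
      unfolding inner_sum_left using w(2) by (intro sum.neutral) (simp add: inner_commute[of _ "f w"])
    finally show ?thesis by (simp add: inner_diff_left inner_add_left)
  qed
  have X_iff: "c \<in> X \<longleftrightarrow> t \<in> {0..1} \<and> (\<lambda>i\<in>{..<k}. c i - ((q - x0) \<bullet> e i + t * (f \<nu> \<bullet> e i))) \<in> ?C"
    if c: "c \<in> extensional ?I" and ck: "c k = (q - x0) \<bullet> f w + t * (f w \<bullet> f \<nu>)" for c t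
  proof -
    have VX: "(\<Sum>i<Suc k. c i *\<^sub>R \<beta> i) = V x \<longleftrightarrow> (\<forall>i<Suc k. c i = f x \<bullet> e' i)" for x
    proof
      assume eq: "(\<Sum>i<Suc k. c i *\<^sub>R \<beta> i) = V x"
      show "\<forall>i<Suc k. c i = f x \<bullet> e' i"
      proof (intro allI impI)
        fix i assume i: "i < Suc k"
        show "c i = f x \<bullet> e' i"
          using inner_orthonormal_sum[OF \<beta>on i, of c] V\<beta>[OF i, of x] eq by simp
      qed
    qed (simp add: V_def)
    have "c \<in> X \<longleftrightarrow> (\<Sum>i<Suc k. c i *\<^sub>R \<beta> i) \<in> Y"
      using c by (simp add: X_def frame_coords_def PiE_def del: sum.lessThan_Suc)
    also have "\<dots> \<longleftrightarrow> (\<exists>s\<in>F. \<exists>t'\<in>{0..1}. (\<Sum>i<Suc k. c i *\<^sub>R \<beta> i) = V (s + t' *\<^sub>R \<nu>))"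
      unfolding Y_def prism_def by (simp only: image_iff bex_simps Bex_def mem_Times_iff) auto
    also have "\<dots> \<longleftrightarrow> (\<exists>s\<in>F. \<exists>t'\<in>{0..1}. \<forall>i<Suc k. c i = f (s + t' *\<^sub>R \<nu>) \<bullet> e' i)"
      unfolding VX ..
    also have "\<dots> \<longleftrightarrow> (\<exists>s\<in>F. \<exists>t'\<in>{0..1}. (\<forall>i<k. c i = f s \<bullet> e i + t' * (f \<nu> \<bullet> e i)) \<and> t = t')"
    proof (intro bex_cong refl)
      fix s t' assume s: "s \<in> F"
      have "(\<forall>i<Suc k. c i = f (s + t' *\<^sub>R \<nu>) \<bullet> e' i)
          \<longleftrightarrow> (\<forall>i<k. c i = f (s + t' *\<^sub>R \<nu>) \<bullet> e i) \<and> c k = f (s + t' *\<^sub>R \<nu>) \<bullet> f w"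
        by (auto simp: less_Suc_eq e'_less e'k)
      moreover have "c k = f (s + t' *\<^sub>R \<nu>) \<bullet> f w \<longleftrightarrow> t = t'"
        using w(4) by (simp add: ck add scale inner_add_left qN[OF s] inner_commute[of "f \<nu>"])
      ultimately show "(\<forall>i<Suc k. c i = f (s + t' *\<^sub>R \<nu>) \<bullet> e' i)
          \<longleftrightarrow> (\<forall>i<k. c i = f s \<bullet> e i + t' * (f \<nu> \<bullet> e i)) \<and> t = t'"
        by (simp add: add scale inner_add_left)
    qed
    also have "\<dots> \<longleftrightarrow> t \<in> {0..1} \<and> (\<exists>s\<in>F. \<forall>i<k. c i = f s \<bullet> e i + t * (f \<nu> \<bullet> e i))"
      by auto
    also have "(\<exists>s\<in>F. \<forall>i<k. c i = f s \<bullet> e i + t * (f \<nu> \<bullet> e i)) \<longleftrightarrow>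
        (\<lambda>i\<in>{..<k}. c i - ((q - x0) \<bullet> e i + t * (f \<nu> \<bullet> e i))) \<in> ?C"
    proof -
      define b where "b i = c i - ((q - x0) \<bullet> e i + t * (f \<nu> \<bullet> e i))" for i
      have "restrict b {..<k} \<in> ?C \<longleftrightarrow> (\<exists>s\<in>F. q + (\<Sum>i<k. b i *\<^sub>R e i) = x0 + f s)"
        by (auto simp: frame_coords_def)
      also have "\<dots> \<longleftrightarrow> (\<exists>s\<in>F. \<forall>i<k. c i = f s \<bullet> e i + t * (f \<nu> \<bullet> e i))"
      proof (intro bex_cong refl)
        fix s assume s: "s \<in> F"
        have "q + (\<Sum>i<k. b i *\<^sub>R e i) = x0 + f s \<longleftrightarrow> (\<forall>i<k. b i = (x0 + f s - q) \<bullet> e i)"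
        proof
          assume "q + (\<Sum>i<k. b i *\<^sub>R e i) = x0 + f s"
          then have "x0 + f s - q = (\<Sum>i<k. b i *\<^sub>R e i)" by (simp add: algebra_simps)
          then show "\<forall>i<k. b i = (x0 + f s - q) \<bullet> e i"
            using inner_orthonormal_sum[OF on] by simp
        next
          assume "\<forall>i<k. b i = (x0 + f s - q) \<bullet> e i"
          then have "(\<Sum>i<k. b i *\<^sub>R e i) = x0 + f s - q"
            by (subst q0[OF s]) simp
          then show "q + (\<Sum>i<k. b i *\<^sub>R e i) = x0 + f s" by simp
        qed
        also have "\<dots> \<longleftrightarrow> (\<forall>i<k. c i = f s \<bullet> e i + t * (f \<nu> \<bullet> e i))"
          by (auto simp: b_def inner_diff_left inner_add_left)
        finally show "q + (\<Sum>i<k. b i *\<^sub>R e i) = x0 + f s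
          \<longleftrightarrow> (\<forall>i<k. c i = f s \<bullet> e i + t * (f \<nu> \<bullet> e i))" .
      qed
      finally show ?thesis unfolding b_def ..
    qed
    finally show ?thesis .
  qed
  have closed: "closed ((\<lambda>s. x0 + f s) ` F)"
    using lin F(1) by (intro compact_imp_closed compact_continuous_image continuous_intros linear_continuous_on)
      (simp_all add: linear_conv_bounded_linear)
  have "emeasure (Pi\<^sub>M ?I (\<lambda>_. lborel)) X = ennreal (f w \<bullet> f \<nu>) * emeasure ?M ?C"
    by (rule slanted_prism_volume[OF sets_frame_coords[OF closed] w(4) Xsets X_iff])
  moreover have "emeasure lborel Y = ennreal \<bar>det (matrix V)\<bar> * emeasure lborel (prism F \<nu>)"
    unfolding Y_def by (rule emeasure_lborel_linear_image[OF Vlin Vinj compact_prism[OF F(1)]])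
  ultimately have "enn2real (ennreal (f w \<bullet> f \<nu>) * emeasure ?M ?C)
      = enn2real (ennreal \<bar>det (matrix V)\<bar> * emeasure lborel (prism F \<nu>))"
    using volY by simp
  then have "measure ?M ?C * (f w \<bullet> f \<nu>) = \<bar>det (matrix V)\<bar> * measure lborel (prism F \<nu>)"
    using w(4) by (simp add: enn2real_mult measure_def mult.commute)
  with w(1,3,4) Vlin Vinner show thesis by (intro that[of w V]) simp_all
qed

lemma flat_measure_affine_image:
  fixes f :: "real^'m \<Rightarrow> 'b::euclidean_space"
  assumes lin: "linear f" and inj: "inj f" and F: "compact F" "F \<noteq> {}"
    and dim: "aff_dim F = int k" and card: "CARD('m) = Suc k"
    and \<nu>: "\<nu> \<noteq> 0" and orth: "\<forall>x\<in>F. \<forall>y\<in>F. \<nu> \<bullet> (x - y) = 0"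
  obtains w V where "norm (f w) = 1"
    "\<forall>d. \<nu> \<bullet> d = 0 \<longrightarrow> f w \<bullet> f d = 0" "f w \<bullet> f \<nu> > 0"
    "linear V" "\<forall>s t. V s \<bullet> V t = f s \<bullet> f t"
    "flat_measure k ((\<lambda>s. x0 + f s) ` F) * (f w \<bullet> f \<nu>)
       = \<bar>det (matrix V)\<bar> * measure lborel (prism F \<nu>)"
proof -
  have im: "(\<lambda>s. x0 + f s) ` F = (+) x0 ` f ` F" by (auto simp: image_image)
  have "aff_dim ((\<lambda>s. x0 + f s) ` F) = int k"
    unfolding im aff_dim_translation_eq using aff_dim_injective_linear_image[OF lin inj] dim by simp
  moreover have "closed ((\<lambda>s. x0 + f s) ` F)"
    using lin F(1) by (intro compact_imp_closed compact_continuous_image continuous_intros linear_continuous_on)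
      (simp_all add: linear_conv_bounded_linear)
  ultimately obtain p e where frame: "flat_frame k ((\<lambda>s. x0 + f s) ` F) p e"
    and fm: "flat_measure k ((\<lambda>s. x0 + f s) ` F)
      = measure (Pi\<^sub>M {..<k} (\<lambda>_. lborel)) (frame_coords k p e ((\<lambda>s. x0 + f s) ` F))"
    by (rule flat_measure_frame)
  obtain w V where w: "norm (f w) = 1"
    "\<forall>d. \<nu> \<bullet> d = 0 \<longrightarrow> f w \<bullet> f d = 0" "f w \<bullet> f \<nu> > 0"
    and V: "linear V" "\<forall>s t. V s \<bullet> V t = f s \<bullet> f t"
    and vol: "measure (Pi\<^sub>M {..<k} (\<lambda>_. lborel)) (frame_coords k p e ((\<lambda>s. x0 + f s) ` F)) * (f w \<bullet> f \<nu>)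
       = \<bar>det (matrix V)\<bar> * measure lborel (prism F \<nu>)"
    by (rule prism_image_volume[OF lin inj F dim card \<nu> orth frame])
  show thesis
    by (rule that[OF w V]) (use vol in \<open>simp_all add: fm\<close>)
qed

section \<open>Gram matrices and the area formula\<close>

lemma matrix_inv_mult_left:
  fixes M :: "real^'n^'n"
  assumes "invertible M"
  shows "matrix_inv M ** M = mat 1"
  using someI_ex[OF assms[unfolded invertible_def]] by (simp add: matrix_inv_def)

lemma inner_gram_matrix:
  fixes A :: "real^'m^'n"
  shows "s \<bullet> ((transpose A ** A) *v t) = (A *v s) \<bullet> (A *v t)"
proof -
  have "s \<bullet> ((transpose A ** A) *v t) = ((A *v t) v* A) \<bullet> s"
    by (simp only: matrix_vector_mul_assoc[symmetric] transpose_matrix_vector inner_commute[of s])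
  also have "\<dots> = (A *v s) \<bullet> (A *v t)"
    unfolding dot_lmul_matrix by (rule inner_commute)
  finally show ?thesis .
qed

text \<open>
  The Gram matrix depends on the inner products of the image vectors only. Hence it does not change when
  the range is mapped isometrically to another space.
\<close>

lemma gram_matrix_eqI:
  fixes A :: "real^'m^'n" and B :: "real^'m^'k"
  assumes "\<And>s t. (A *v s) \<bullet> (A *v t) = (B *v s) \<bullet> (B *v t)"
  shows "transpose A ** A = transpose B ** B"
proof -
  have "\<forall>s. s \<bullet> ((transpose A ** A) *v t) = s \<bullet> ((transpose B ** B) *v t)" for t
    by (simp add: inner_gram_matrix assms)
  then show ?thesis by (simp add: vector_eq_ldot matrix_eq)
qed

text \<open>
  Here the height \<open>\<mu> = A w \<bullet> A \<nu>\<close> of the slanted prism is eliminated: \<open>A w\<close> is a unit vector orthogonal to the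
  image of the hyperplane \<open>{d. \<nu> \<bullet> d = 0}\<close>, so that \<open>A\<^sup>T A w = \<mu> \<nu>\<close> and \<open>\<mu>\<^sup>2 ((A\<^sup>T A)\<^sup>-\<^sup>1 \<nu> \<bullet> \<nu>) = 1\<close>.
\<close>

lemma flat_measure_matrix_image:
  fixes A :: "real^'m^'n"
  assumes inj: "inj ((*v) A)" and F: "compact F" "F \<noteq> {}"
    and dim: "aff_dim F = int k" and card: "CARD('m) = Suc k"
    and \<nu>: "norm \<nu> = 1" and orth: "\<forall>x\<in>F. \<forall>y\<in>F. \<nu> \<bullet> (x - y) = 0"
  shows "(flat_measure k ((\<lambda>s. x0 + A *v s) ` F))\<^sup>2
       = det (transpose A ** A) * ((matrix_inv (transpose A ** A) *v \<nu>) \<bullet> \<nu>)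
         * (measure lborel (prism F \<nu>))\<^sup>2"
    and "invertible (transpose A ** A)"
proof -
  let ?M = "transpose A ** A"
  have \<nu>0: "\<nu> \<noteq> 0" using \<nu> by auto
  have \<nu>\<nu>: "\<nu> \<bullet> \<nu> = 1" using \<nu> by (simp add: norm_eq_1)
  obtain w V where w: "norm (A *v w) = 1" "\<forall>d. \<nu> \<bullet> d = 0 \<longrightarrow> (A *v w) \<bullet> (A *v d) = 0"
      "(A *v w) \<bullet> (A *v \<nu>) > 0"
    and V: "linear V" "\<forall>s t. V s \<bullet> V t = (A *v s) \<bullet> (A *v t)"
    and vol: "flat_measure k ((\<lambda>s. x0 + A *v s) ` F) * ((A *v w) \<bullet> (A *v \<nu>))
       = \<bar>det (matrix V)\<bar> * measure lborel (prism F \<nu>)"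
    by (rule flat_measure_affine_image[where ?x0.0 = x0, OF matrix_vector_mul_linear inj F dim card \<nu>0 orth])
  define \<mu> where "\<mu> = (A *v w) \<bullet> (A *v \<nu>)"
  have "?M = transpose (matrix V) ** matrix V"
    using V by (intro gram_matrix_eqI) (simp add: matrix_works)
  then have det: "det ?M = (det (matrix V))\<^sup>2"
    by (simp add: det_mul det_transpose power2_eq_square)
  have "?M *v x = 0 \<Longrightarrow> x = 0" for x
    using inner_gram_matrix[of x A x] inj by (metis inj_eq inner_eq_zero_iff inner_zero_right matrix_vector_mult_0_right)
  then show invM: "invertible ?M"
    by (metis invertible_left_inverse matrix_left_invertible_ker)
  have Mw: "?M *v w = \<mu> *\<^sub>R \<nu>"
  proof (rule vector_eq_ldot[THEN iffD1], rule allI)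
    fix s
    \<comment> \<open>Only the component of \<open>s\<close> along \<open>\<nu>\<close> contributes to \<open>A w \<bullet> A s\<close>.\<close>
    have "\<nu> \<bullet> (s - (\<nu> \<bullet> s) *\<^sub>R \<nu>) = 0" by (simp add: inner_diff_right \<nu>\<nu>)
    from w(2)[rule_format, OF this] have "(A *v w) \<bullet> (A *v s) = (\<nu> \<bullet> s) * \<mu>"
      by (simp add: matrix_vector_mult_diff_distrib matrix_vector_mult_scaleR inner_diff_right \<mu>_def)
    then show "s \<bullet> (?M *v w) = s \<bullet> (\<mu> *\<^sub>R \<nu>)"
      by (simp add: inner_gram_matrix inner_commute)
  qed
  have "w = matrix_inv ?M *v (?M *v w)"
    using invM by (simp add: matrix_vector_mul_assoc matrix_inv_mult_left)
  then have w_eq: "w = \<mu> *\<^sub>R (matrix_inv ?M *v \<nu>)"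
    by (simp add: Mw matrix_vector_mult_scaleR)
  have "1 = w \<bullet> (?M *v w)" using w(1) by (simp add: inner_gram_matrix norm_eq_1)
  also have "\<dots> = \<mu>\<^sup>2 * ((matrix_inv ?M *v \<nu>) \<bullet> \<nu>)"
    unfolding Mw by (subst w_eq) (simp add: power2_eq_square)
  finally have one: "\<mu>\<^sup>2 * ((matrix_inv ?M *v \<nu>) \<bullet> \<nu>) = 1" ..
  let ?S = "flat_measure k ((\<lambda>s. x0 + A *v s) ` F)"
  have "?S\<^sup>2 = (?S * \<mu>)\<^sup>2 * ((matrix_inv ?M *v \<nu>) \<bullet> \<nu>)"
    using one by (simp add: power_mult_distrib)
  also have "(?S * \<mu>)\<^sup>2 = det ?M * (measure lborel (prism F \<nu>))\<^sup>2"
    unfolding vol[folded \<mu>_def] det by (simp add: power_mult_distrib)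
  finally show "?S\<^sup>2 = det ?M * ((matrix_inv ?M *v \<nu>) \<bullet> \<nu>) * (measure lborel (prism F \<nu>))\<^sup>2"
    by (simp add: mult_ac)
qed

theorem theorem8p2:
  fixes A :: "real^'m^'n"
    and x0 \<nu> and Sigma_s sigma_s :: "(real^'m) set"
    and Sigma sigma :: "(real^'n) set"
  assumes "1 \<le> CARD('m)" and "CARD('m) \<le> CARD('n)"
    and "flat_polytope Sigma_s"
    and "inj (\<lambda>j. column j A)" and "independent (columns A)"
    and "Sigma = (\<lambda>s. x0 + A *v s) ` Sigma_s"
    and "flat_face Sigma_s sigma_s"
    and "outward_unit_normal Sigma_s sigma_s \<nu>"
    and "sigma = (\<lambda>s. x0 + A *v s) ` sigma_s"
  shows "(flat_measure (CARD('m) - 1) sigma)\<^sup>2 / (flat_measure (CARD('m) - 1) sigma_s)\<^sup>2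
           = det (transpose A ** A) * ((matrix_inv (transpose A ** A) *v \<nu>) \<bullet> \<nu>)
       \<and> (flat_measure (CARD('m) - 1) sigma)\<^sup>2 / (flat_measure (CARD('m) - 1) sigma_s)\<^sup>2
           = (cofactor_matrix (transpose A ** A) *v \<nu>) \<bullet> \<nu>"
proof -
  let ?M = "transpose A ** A"
  let ?k = "CARD('m) - 1"
  have card: "CARD('m) = Suc ?k" using assms(1) by simp
  have F: "compact sigma_s" "rel_interior sigma_s \<noteq> {}" and dim: "aff_dim sigma_s = int CARD('m) - 1"
    using assms(7) by (auto simp: flat_face_def)
  then have dimk: "aff_dim sigma_s = int ?k" and ne: "sigma_s \<noteq> {}"
    using assms(1) rel_interior_empty by (auto simp: of_nat_diff)
  have \<nu>: "norm \<nu> = 1" and orth: "\<forall>x\<in>sigma_s. \<forall>y\<in>sigma_s. \<nu> \<bullet> (x - y) = 0"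
    using assms(8) by (auto simp: outward_unit_normal_def)
  have "\<forall>c. (\<Sum>i\<in>UNIV. c i *s column i A) = 0 \<longrightarrow> (\<forall>i. c i = 0)"
  proof (intro allI impI)
    fix c :: "'m \<Rightarrow> real" and i
    assume 0: "(\<Sum>i\<in>UNIV. c i *s column i A) = 0"
    define g where "g j = column j A" for j
    have g: "inj g" and cols: "columns A = range g"
      using assms(4) by (auto simp: g_def[abs_def] columns_def)
    have "(\<Sum>v\<in>columns A. c (inv g v) *\<^sub>R v) = (\<Sum>i\<in>UNIV. c i *s g i)"
      unfolding cols using g by (simp add: sum.reindex scalar_mult_eq_scaleR)
    with 0 have "(\<Sum>v\<in>columns A. c (inv g v) *\<^sub>R v) = 0" by (simp add: g_def)
    then have "\<forall>v\<in>columns A. c (inv g v) = 0"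
      using assms(5)[unfolded independent_explicit, THEN conjunct2, rule_format, of "\<lambda>v. c (inv g v)"] by simp
    then show "c i = 0" using g by (auto simp: cols)
  qed
  then have inj: "inj ((*v) A)"
    using matrix_left_invertible_independent_columns matrix_left_invertible_injective by blast
  let ?P = "measure lborel (prism sigma_s \<nu>)"
  have P: "?P > 0"
    by (rule measure_prism_pos) (use F dim \<nu> orth in auto)
  have sigma: "(flat_measure ?k sigma)\<^sup>2 = det ?M * ((matrix_inv ?M *v \<nu>) \<bullet> \<nu>) * ?P\<^sup>2"
    unfolding assms(9) by (rule flat_measure_matrix_image(1)[OF inj F(1) ne dimk card \<nu> orth])
  have invM: "invertible ?M"
    by (rule flat_measure_matrix_image(2)[OF inj F(1) ne dimk card \<nu> orth])
  have I: "inj ((*v) (mat 1 :: real^'m^'m))" by (auto intro: injI)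
  have inv1: "matrix_inv (mat 1 :: real^'m^'m) = mat 1"
    using matrix_inv_mult_left[of "mat 1 :: real^'m^'m"] by (simp add: invertible_det_nz)
  \<comment> \<open>For the identity matrix the factor is \<open>\<nu> \<bullet> \<nu> = 1\<close>.\<close>
  have sigma_s: "(flat_measure ?k sigma_s)\<^sup>2 = ?P\<^sup>2"
    using flat_measure_matrix_image(1)[OF I F(1) ne dimk card \<nu> orth, of 0] \<nu>
    by (simp add: transpose_mat inv1 norm_eq_1)
  have 1: "(flat_measure ?k sigma)\<^sup>2 / (flat_measure ?k sigma_s)\<^sup>2 = det ?M * ((matrix_inv ?M *v \<nu>) \<bullet> \<nu>)"
    unfolding sigma sigma_s using P by simp
  have "det ?M * ((matrix_inv ?M *v \<nu>) \<bullet> \<nu>) = ((det ?M *\<^sub>R matrix_inv ?M) *v \<nu>) \<bullet> \<nu>"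
    by (simp add: scaleR_matrix_vector_assoc[symmetric])
  also have "\<dots> = (cofactor_matrix ?M *v \<nu>) \<bullet> \<nu>"
    unfolding det_matrix_inv_cofactor_matrix[OF invM] transpose_matrix_vector dot_lmul_matrix
    by (rule inner_commute)
  finally show ?thesis using 1 by simp
qed

end
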